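(* Let $C = b_0 + K_{n=1}^{\infty} a_n/b_n$ be a continued fraction with complex elements whose odd and even parts converge to different limits. Suppose further that there exist positive constants $c_1, c_2, c_3$ such that, for all $i \geq 1$, $$c_1 \leq |b_i| \leq c_2 \qquad\text{and}\qquad \left|\frac{a_{2i+1}}{a_{2i}}\right| \leq c_3 .$$ Then $C$ does not converge generally (that is, there is no $f \in \hat{\mathbb{C}}$ to which $C$ converges generally).
   Context: $b_0+K_{n=1}^{\infty} a_n/b_n$ denotes the continued fraction $b_0+\cfrac{a_1}{b_1+\cfrac{a_2}{b_2+\cdots}}$. Its $n$-th approximant is $A_n/B_n$, where $A_{-1}=1$, $A_0=b_0$, $B_{-1}=0$, $B_0=1$, and $A_n=b_nA_{n-1}+a_nA_{n-2}$, $B_n=b_nB_{n-1}+a_nB_{n-2}$ for $n\ge 1$. The even part is the continued fraction whose $n$-th numerator and denominator convergents are $A_{2n}$ and $B_{2n}$ ($n\ge 0$). The odd part is the continued fraction whose zeroth numerator and denominator convergents are $A_1/B_1$ and $1$, and whose $n$-th numerator and denominator convergents are $A_{2n+1}$ and $B_{2n+1}$ ($n\ge1$). Thus the even (respectively odd) part converges to a limit when $A_{2n}/B_{2n}$ (respectively $A_{2n+1}/B_{2n+1}$) tends to that limit as $n\to\infty$; here limits of the odd and even parts are elements of $\mathbb{C}$. Write $\hat{\mathbb{C}}=\mathbb{C}\cup\{\infty\}$ and $S_n(w)=\dfrac{A_n+wA_{n-1}}{B_n+wB_{n-1}}$ for $w\in\hat{\mathbb{C}}$ (with $S_n(\infty)=A_{n-1}/B_{n-1}$).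 The chordal metric on $\hat{\mathbb{C}}$ is $d(w,z)=\dfrac{|z-w|}{\sqrt{1+|w|^2}\sqrt{1+|z|^2}}$ for $w,z$ finite, $d(w,\infty)=\dfrac{1}{\sqrt{1+|w|^2}}$ for $w$ finite, and $d(\infty,\infty)=0$. The continued fraction converges generally to $f\in\hat{\mathbb{C}}$ if there exist sequences $\{v_n\},\{w_n\}\subset\hat{\mathbb{C}}$ with $\liminf_{n\to\infty} d(v_n,w_n)>0$ and $\lim_{n\to\infty}S_n(v_n)=\lim_{n\to\infty}S_n(w_n)=f$ (limits in $\hat{\mathbb{C}}$). *)

theory Defs
  imports "HOL-Analysis.Analysis"
begin

text \<open>
  A continued fraction \<open>b 0 + K (a n / b n)\<close> is given by the two sequences
  \<open>a, b\<close>; the value \<open>a 0\<close> is never used.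
\<close>

text \<open>
  The recurrences start at index -1, so the two sequences below are shifted by one:
  \<open>cf_num_shift a b n\<close> is $A_{n-1}$ and \<open>cf_den_shift a b n\<close> is $B_{n-1}$.
\<close>

fun cf_num_shift :: "(nat \<Rightarrow> complex) \<Rightarrow> (nat \<Rightarrow> complex) \<Rightarrow> nat \<Rightarrow> complex" where
  "cf_num_shift a b 0 = 1"
| "cf_num_shift a b (Suc 0) = b 0"
| "cf_num_shift a b (Suc (Suc n)) =
     b (Suc n) * cf_num_shift a b (Suc n) + a (Suc n) * cf_num_shift a b n"

fun cf_den_shift :: "(nat \<Rightarrow> complex) \<Rightarrow> (nat \<Rightarrow> complex) \<Rightarrow> nat \<Rightarrow> complex" where
  "cf_den_shift a b 0 = 0"
| "cf_den_shift a b (Suc 0) = 1"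
| "cf_den_shift a b (Suc (Suc n)) =
     b (Suc n) * cf_den_shift a b (Suc n) + a (Suc n) * cf_den_shift a b n"

definition cf_num :: "(nat \<Rightarrow> complex) \<Rightarrow> (nat \<Rightarrow> complex) \<Rightarrow> nat \<Rightarrow> complex" where
  "cf_num a b n = cf_num_shift a b (Suc n)"

definition cf_den :: "(nat \<Rightarrow> complex) \<Rightarrow> (nat \<Rightarrow> complex) \<Rightarrow> nat \<Rightarrow> complex" where
  "cf_den a b n = cf_den_shift a b (Suc n)"

datatype xcomplex = Fin complex | Infty

fun chordal :: "xcomplex \<Rightarrow> xcomplex \<Rightarrow> real" where
  "chordal (Fin w) (Fin z) =
     cmod (z - w) / (sqrt (1 + (cmod w)\<^sup>2) * sqrt (1 + (cmod z)\<^sup>2))"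
| "chordal (Fin w) Infty = 1 / sqrt (1 + (cmod w)\<^sup>2)"
| "chordal Infty (Fin w) = 1 / sqrt (1 + (cmod w)\<^sup>2)"
| "chordal Infty Infty = 0"

definition xc_tendsto :: "(nat \<Rightarrow> xcomplex) \<Rightarrow> xcomplex \<Rightarrow> bool" where
  "xc_tendsto x f \<longleftrightarrow> (\<lambda>n. chordal (x n) f) \<longlonglongrightarrow> 0"

text \<open>
  A quotient with vanishing denominator is \<open>Infty\<close>. The indeterminate
  quotient 0/0 also receives this value; it cannot occur as an approximant, nor as a
  value of \<open>cf_S\<close>, when \<open>a n \<noteq> 0\<close> for all \<open>n \<ge> 1\<close>, since
  then $A_n B_{n-1} - A_{n-1} B_n \neq 0$.
\<close>

definition xc_quot :: "complex \<Rightarrow> complex \<Rightarrow> xcomplex" where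
  "xc_quot p q = (if q = 0 then Infty else Fin (p / q))"

definition cf_approximant :: "(nat \<Rightarrow> complex) \<Rightarrow> (nat \<Rightarrow> complex) \<Rightarrow> nat \<Rightarrow> xcomplex" where
  "cf_approximant a b n = xc_quot (cf_num a b n) (cf_den a b n)"

text \<open>
  Finitely many approximants may be infinite. Convergence to \<open>Fin l\<close> forces the
  denominators $B_{2n}$ (respectively $B_{2n+1}$) to be nonzero for all large n.
\<close>

definition cf_even_part_converges_to ::
  "(nat \<Rightarrow> complex) \<Rightarrow> (nat \<Rightarrow> complex) \<Rightarrow> complex \<Rightarrow> bool" where
  "cf_even_part_converges_to a b l \<longleftrightarrow> xc_tendsto (\<lambda>n. cf_approximant a b (2 * n)) (Fin l)"

definition cf_odd_part_converges_to ::
  "(nat \<Rightarrow> complex) \<Rightarrow> (nat \<Rightarrow> complex) \<Rightarrow> complex \<Rightarrow> bool" where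
  "cf_odd_part_converges_to a b l \<longleftrightarrow> xc_tendsto (\<lambda>n. cf_approximant a b (2 * n + 1)) (Fin l)"

text \<open>By the index shift, the argument \<open>n\<close> below refers to $A_{n-1}$ and $B_{n-1}$.\<close>

fun cf_S :: "(nat \<Rightarrow> complex) \<Rightarrow> (nat \<Rightarrow> complex) \<Rightarrow> nat \<Rightarrow> xcomplex \<Rightarrow> xcomplex" where
  "cf_S a b n (Fin w) =
     xc_quot (cf_num a b n + w * cf_num_shift a b n) (cf_den a b n + w * cf_den_shift a b n)"
| "cf_S a b n Infty = xc_quot (cf_num_shift a b n) (cf_den_shift a b n)"

text \<open>The limit inferior is taken in \<open>ereal\<close>, as \<open>real\<close> is not a complete lattice.\<close>

definition cf_converges_generally_to ::
  "(nat \<Rightarrow> complex) \<Rightarrow> (nat \<Rightarrow> complex) \<Rightarrow> xcomplex \<Rightarrow> bool" where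
  "cf_converges_generally_to a b f \<longleftrightarrow>
     (\<exists>v w :: nat \<Rightarrow> xcomplex.
        liminf (\<lambda>n. ereal (chordal (v n) (w n))) > 0 \<and>
        xc_tendsto (\<lambda>n. cf_S a b n (v n)) f \<and>
        xc_tendsto (\<lambda>n. cf_S a b n (w n)) f)"

end

theory Submission
  imports Defs
begin

text \<open>
  Write $f_n = A_n/B_n$. The recurrences say that $f_{n+2}$ is the weighted mean of $f_{n+1}$ and
  $f_n$ with weights $b_{n+2} B_{n+1}/B_{n+2}$ and $a_{n+2} B_n/B_{n+2}$, so
  \[ f_{n+2} - f_n = \frac{b_{n+2} B_{n+1}}{B_{n+2}} (f_{n+1} - f_n). \]
  If the even and odd parts have different finite limits, the left-hand side tends to 0 while
  $|f_{n+1} - f_n|$ stays away from 0. Hence $b_n B_{n-1}/B_n \to 0$, and as $|b_n|$ is bounded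
  below, $B_{n-1}/B_n \to 0$ (lemma \<open>den_ratio_tendsto_0\<close>).

  In the same way $S_n(w)$ is a weighted mean of $f_n$ and $f_{n-1}$, and the weight of $f_{n-1}$ is
  $wr/(1 + wr)$ with $r = B_{n-1}/B_n$. So $S_n(w) - f_n \to 0$, uniformly for $w$ in a bounded set
  (lemma \<open>cf_S_near_approximant\<close>).

  Now let $d(v_n, w_n)$ stay away from 0. Then $v_n$ and $w_n$ cannot both be close to $\infty$, so
  for each large $n$ one of them lies in a fixed disc (lemma \<open>chordal_large_le\<close>). Choosing that one
  gives a bounded sequence $u_n$ with $S_n(u_n) - f_n \to 0$. If $S_n(v_n)$ and $S_n(w_n)$ both
  tended to $f$, so would $S_n(u_n)$; even indices then show that $f$ is the limit of the even part,
  and odd indices that it is the limit of the odd part, which contradicts that these differ.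
\<close>

section \<open>The chordal metric\<close>

lemma sqrt_one_plus_square_le: "x \<ge> 0 \<Longrightarrow> sqrt (1 + x\<^sup>2) \<le> 1 + x" for x :: real
  by (rule real_le_lsqrt) (auto simp: power2_eq_square algebra_simps)

lemma le_sqrt_one_plus_square: "x \<le> sqrt (1 + x\<^sup>2)" for x :: real
  by (rule real_le_rsqrt) simp

lemma sqrt_one_plus_square_pos: "sqrt (1 + x\<^sup>2) > 0" for x :: real
  by (simp add: add_pos_nonneg)

lemma chordal_nonneg: "chordal x y \<ge> 0"
  by (cases x; cases y) auto

text \<open>
  The factor $\sqrt{1+|y|^2}$ that separates the two metrics is at most $1 + |l| + |y - l|$. When the
  chordal distance is small, the contribution of $|y - l|$ to this factor can be absorbed into the
  left-hand side.
\<close>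

lemma dist_le_chordal:
  assumes "chordal (Fin y) (Fin l) * (1 + cmod l) \<le> 1 / 2"
  shows "cmod (y - l) \<le> 2 * (1 + cmod l)\<^sup>2 * chordal (Fin y) (Fin l)"
proof -
  define d K where "d = chordal (Fin y) (Fin l)" and "K = 1 + cmod l"
  have d0: "d \<ge> 0" by (simp add: d_def chordal_nonneg)
  have "cmod (y - l) = d * (sqrt (1 + (cmod y)\<^sup>2) * sqrt (1 + (cmod l)\<^sup>2))"
    using sqrt_one_plus_square_pos[of "cmod y"] sqrt_one_plus_square_pos[of "cmod l"]
    by (simp add: d_def norm_minus_commute)
  also have "\<dots> \<le> d * ((K + cmod (y - l)) * K)"
  proof (intro mult_left_mono mult_mono d0)
    have "cmod y \<le> cmod l + cmod (y - l)" by (metis norm_triangle_sub)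
    then show "sqrt (1 + (cmod y)\<^sup>2) \<le> K + cmod (y - l)"
      using sqrt_one_plus_square_le[of "cmod y"] by (simp add: K_def)
    show "sqrt (1 + (cmod l)\<^sup>2) \<le> K"
      using sqrt_one_plus_square_le[of "cmod l"] by (simp add: K_def)
  qed (auto simp: K_def)
  finally have "cmod (y - l) \<le> d * K\<^sup>2 + (d * K) * cmod (y - l)"
    by (simp add: algebra_simps power2_eq_square)
  also have "(d * K) * cmod (y - l) \<le> 1 / 2 * cmod (y - l)"
    using assms by (intro mult_right_mono) (auto simp: d_def K_def)
  finally show ?thesis
    unfolding d_def[symmetric] K_def[symmetric] by (simp add: mult_ac)
qed

lemma xc_tendsto_quot_FinD:
  assumes "xc_tendsto (\<lambda>n. xc_quot (p n) (q n)) (Fin l)"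
  shows "eventually (\<lambda>n. q n \<noteq> 0) sequentially" and "(\<lambda>n. p n / q n) \<longlonglongrightarrow> l"
proof -
  define K where "K = 1 + cmod l"
  define d where "d n = chordal (xc_quot (p n) (q n)) (Fin l)" for n
  have K: "K > 0" by (simp add: K_def add_pos_nonneg)
  have d: "d \<longlonglongrightarrow> 0" using assms by (simp add: xc_tendsto_def d_def[abs_def])
  \<comment> \<open>The bound is the chordal distance of \<open>l\<close> from \<open>\<infinity>\<close>.\<close>
  have "eventually (\<lambda>n. d n < 1 / sqrt (1 + (cmod l)\<^sup>2)) sequentially"
    using order_tendstoD(2)[OF d] sqrt_one_plus_square_pos[of "cmod l"] by simp
  then show nz: "eventually (\<lambda>n. q n \<noteq> 0) sequentially"
    by eventually_elim (auto simp: d_def xc_quot_def split: if_splits)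
  have "eventually (\<lambda>n. d n < 1 / (2 * K)) sequentially"
    using order_tendstoD(2)[OF d] K by simp
  with nz have "eventually (\<lambda>n. norm (p n / q n - l) \<le> 2 * K\<^sup>2 * d n) sequentially"
  proof eventually_elim
    case (elim n)
    have "d n * K \<le> 1 / 2" using elim(2) K by (simp add: field_simps)
    then show ?case
      using dist_le_chordal[of "p n / q n" l] elim(1) by (simp add: d_def K_def xc_quot_def)
  qed
  moreover have "(\<lambda>n. 2 * K\<^sup>2 * d n) \<longlonglongrightarrow> 0"
    using tendsto_mult_left[OF d, of "2 * K\<^sup>2"] by simp
  ultimately have "(\<lambda>n. p n / q n - l) \<longlonglongrightarrow> 0"
    by (rule Lim_null_comparison)
  then show "(\<lambda>n. p n / q n) \<longlonglongrightarrow> l" by (simp add: LIM_zero_iff)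
qed

text \<open>The chordal distance to \<open>f\<close> is continuous on the plane and vanishes only at \<open>f\<close>.\<close>

lemma xc_tendsto_Fin_unique:
  assumes "xc_tendsto (\<lambda>n. Fin (y n)) f" and "y \<longlonglongrightarrow> l"
  shows "f = Fin l"
proof -
  have pos: "sqrt (1 + (cmod z)\<^sup>2) \<noteq> 0" for z
    using sqrt_one_plus_square_pos[of "cmod z"] by linarith
  have "(\<lambda>n. chordal (Fin (y n)) f) \<longlonglongrightarrow> chordal (Fin l) f"
    using pos by (cases f) (auto intro!: tendsto_intros assms(2))
  with assms(1) have "chordal (Fin l) f = 0"
    by (auto simp: xc_tendsto_def dest: LIMSEQ_unique)
  with pos show ?thesis by (cases f) auto
qed

lemma chordal_Fin_le:
  "chordal (Fin z) (Fin w) \<le> 1 / sqrt (1 + (cmod z)\<^sup>2) + 1 / sqrt (1 + (cmod w)\<^sup>2)"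
proof -
  let ?s = "\<lambda>z. sqrt (1 + (cmod z)\<^sup>2)"
  note pos = sqrt_one_plus_square_pos
  have "cmod (w - z) \<le> cmod w + cmod z" by (rule norm_triangle_ineq4)
  also have "\<dots> \<le> ?s w + ?s z" by (intro add_mono le_sqrt_one_plus_square)
  finally have "chordal (Fin z) (Fin w) \<le> (?s w + ?s z) / (?s z * ?s w)"
    by (simp add: divide_right_mono)
  also have "\<dots> = 1 / ?s z + 1 / ?s w"
    using pos[of "cmod z"] pos[of "cmod w"] by (simp add: field_simps)
  finally show ?thesis .
qed

text \<open>
  Two points outside the disc of radius \<open>R\<close> are both within \<open>1 / R\<close> of \<open>\<infinity>\<close>, hence close to
  each other.
\<close>

lemma chordal_large_le:
  assumes "R > 0"
    and v: "\<And>z. v = Fin z \<Longrightarrow> R \<le> cmod z" and w: "\<And>z. w = Fin z \<Longrightarrow> R \<le> cmod z"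
  shows "chordal v w \<le> 2 / R"
proof -
  have inv: "1 / sqrt (1 + (cmod z)\<^sup>2) \<le> 1 / R" if "R \<le> cmod z" for z
  proof -
    have "R \<le> sqrt (1 + (cmod z)\<^sup>2)"
      using that le_sqrt_one_plus_square[of "cmod z"] by linarith
    with \<open>R > 0\<close> show ?thesis by (simp add: frac_le)
  qed
  have R: "1 / R > 0" "2 / R = 1 / R + 1 / R" using \<open>R > 0\<close> by auto
  show ?thesis
  proof (cases v)
    case v': (Fin z)
    show ?thesis
    proof (cases w)
      case (Fin z')
      show ?thesis
        using chordal_Fin_le[of z z'] inv[OF v[OF v']] inv[OF w[OF Fin]] R
        unfolding v' Fin by linarith
    next
      case Infty
      show ?thesis using inv[OF v[OF v']] R unfolding v' Infty chordal.simps by linarith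
    qed
  next
    case v': Infty
    show ?thesis
    proof (cases w)
      case (Fin z')
      show ?thesis using inv[OF w[OF Fin]] R unfolding v' Fin chordal.simps by linarith
    next
      case Infty
      show ?thesis using R unfolding v' Infty chordal.simps by linarith
    qed
  qed
qed

section \<open>Sequences split by parity\<close>

lemma eventually_sequentially_parity:
  assumes "eventually (\<lambda>n. P (2 * n)) sequentially"
    and "eventually (\<lambda>n. P (2 * n + 1)) sequentially"
  shows "eventually P sequentially"
proof -
  obtain M N where M: "\<And>n. n \<ge> M \<Longrightarrow> P (2 * n)" and N: "\<And>n. n \<ge> N \<Longrightarrow> P (2 * n + 1)"
    using assms by (auto simp: eventually_sequentially)
  have "P n" if "n \<ge> 2 * M + 2 * N + 1" for n
    using M[of "n div 2"] N[of "n div 2"] that by (cases "even n") auto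
  then show ?thesis by (auto simp: eventually_sequentially)
qed

lemma LIMSEQ_parity:
  fixes x :: "nat \<Rightarrow> 'a :: topological_space"
  assumes "(\<lambda>n. x (2 * n)) \<longlonglongrightarrow> l" and "(\<lambda>n. x (2 * n + 1)) \<longlonglongrightarrow> l"
  shows "x \<longlonglongrightarrow> l"
  using assms by (auto simp: tendsto_def intro: eventually_sequentially_parity)

lemma filterlim_double_sequentially:
  "filterlim (\<lambda>n::nat. 2 * n) sequentially sequentially"
  "filterlim (\<lambda>n::nat. 2 * n + 1) sequentially sequentially"
  by (auto intro!: filterlim_subseq simp: strict_mono_def)

section \<open>Ratios of consecutive denominators\<close>

lemma cf_num_Suc_Suc:
  "cf_num a b (Suc (Suc n)) = b (Suc (Suc n)) * cf_num a b (Suc n) + a (Suc (Suc n)) * cf_num a b n"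
  and cf_den_Suc_Suc:
  "cf_den a b (Suc (Suc n)) = b (Suc (Suc n)) * cf_den a b (Suc n) + a (Suc (Suc n)) * cf_den a b n"
  by (simp_all add: cf_num_def cf_den_def)

text \<open>
  A linear combination of two numerators over the same combination of the denominators is a weighted
  mean of the two quotients; subtracting one quotient leaves the other weight.
\<close>

lemma mediant_diff:
  fixes p q p' q' s t :: "'a :: field"
  assumes "q \<noteq> 0" "q' \<noteq> 0" "s * q + t * q' \<noteq> 0"
  shows "(s * p + t * p') / (s * q + t * q') - p' / q' =
    s * q / (s * q + t * q') * (p / q - p' / q')"
  using assms by (simp add: divide_simps) (simp add: algebra_simps)

lemma den_ratio_tendsto_0:
  assumes even: "(\<lambda>n. cf_num a b (2 * n) / cf_den a b (2 * n)) \<longlonglongrightarrow> p"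
    and odd: "(\<lambda>n. cf_num a b (2 * n + 1) / cf_den a b (2 * n + 1)) \<longlonglongrightarrow> q"
    and "p \<noteq> q"
    and nz: "eventually (\<lambda>n. cf_den a b n \<noteq> 0) sequentially"
    and "c > 0" and b: "\<And>i. i \<ge> 1 \<Longrightarrow> c \<le> cmod (b i)"
  shows "(\<lambda>n. cf_den a b n / cf_den a b (Suc n)) \<longlonglongrightarrow> 0"
proof -
  define y where "y n = cf_num a b n / cf_den a b n" for n
  define r where "r n = cf_den a b n / cf_den a b (Suc n)" for n
  have e: "(\<lambda>n. y (2 * n)) \<longlonglongrightarrow> p" and o: "(\<lambda>n. y (Suc (2 * n))) \<longlonglongrightarrow> q"
    using even odd by (simp_all add: y_def)
  have e2: "(\<lambda>n. y (Suc (Suc (2 * n)))) \<longlonglongrightarrow> p" and o2: "(\<lambda>n. y (Suc (Suc (Suc (2 * n))))) \<longlonglongrightarrow> q"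
    using LIMSEQ_Suc[OF e] LIMSEQ_Suc[OF o] by simp_all
  have two: "(\<lambda>n. y (Suc (Suc n)) - y n) \<longlonglongrightarrow> 0"
    using tendsto_diff[OF e2 e] tendsto_diff[OF o2 o]
    by - (rule LIMSEQ_parity; simp)
  have one: "(\<lambda>n. cmod (y (Suc n) - y n)) \<longlonglongrightarrow> cmod (p - q)"
    using tendsto_norm[OF tendsto_diff[OF o e]] tendsto_norm[OF tendsto_diff[OF e2 o]]
    by - (rule LIMSEQ_parity; simp add: norm_minus_commute)
  have away: "eventually (\<lambda>n. cmod (y (Suc n) - y n) > 0) sequentially"
    using order_tendstoD(1)[OF one, of 0] \<open>p \<noteq> q\<close> by simp
  have quot: "(\<lambda>n. cmod (y (Suc (Suc n)) - y n) / cmod (y (Suc n) - y n)) \<longlonglongrightarrow> 0"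
    using tendsto_divide[OF tendsto_norm[OF two] one] \<open>p \<noteq> q\<close> by simp
  have nz': "eventually (\<lambda>n. cf_den a b (n + k) \<noteq> 0) sequentially" for k
    using nz eventually_sequentially_seg[of "\<lambda>n. cf_den a b n \<noteq> 0" k] by blast
  have "eventually (\<lambda>n. norm (r (Suc n)) \<le>
      cmod (y (Suc (Suc n)) - y n) / cmod (y (Suc n) - y n) / c) sequentially"
    using nz'[of 0] nz'[of 1] nz'[of 2] away
  proof eventually_elim
    case (elim n)
    have "y (Suc (Suc n)) - y n = b (Suc (Suc n)) * r (Suc n) * (y (Suc n) - y n)"
      using mediant_diff[of "cf_den a b (Suc n)" "cf_den a b n" "b (Suc (Suc n))" "a (Suc (Suc n))"
          "cf_num a b (Suc n)" "cf_num a b n"] elim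
      by (simp add: y_def r_def cf_num_Suc_Suc cf_den_Suc_Suc)
    with elim(4) have "cmod (y (Suc (Suc n)) - y n) / cmod (y (Suc n) - y n)
        = cmod (b (Suc (Suc n))) * cmod (r (Suc n))"
      by (simp add: norm_mult)
    moreover have "c * cmod (r (Suc n)) \<le> cmod (b (Suc (Suc n))) * cmod (r (Suc n))"
      by (intro mult_right_mono b) auto
    ultimately show ?case using \<open>c > 0\<close> by (simp add: field_simps)
  qed
  moreover have "(\<lambda>n. cmod (y (Suc (Suc n)) - y n) / cmod (y (Suc n) - y n) / c) \<longlonglongrightarrow> 0"
    using tendsto_divide[OF quot tendsto_const, of c] \<open>c > 0\<close> by simp
  ultimately have "(\<lambda>n. r (Suc n)) \<longlonglongrightarrow> 0" by (rule Lim_null_comparison)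
  then show ?thesis unfolding r_def[abs_def] by (rule LIMSEQ_imp_Suc)
qed

section \<open>The modified approximants at bounded arguments\<close>

text \<open>
  With $t = u_n B_{n-1}/B_n$, the difference $S_n(u_n) - f_n$ is $\frac{t}{1+t}(f_{n-1} - f_n)$. The
  first factor tends to 0 and the second is bounded, so the approximants may oscillate without
  affecting the conclusion.
\<close>

lemma cf_S_near_approximant:
  assumes nz: "eventually (\<lambda>n. cf_den a b n \<noteq> 0) sequentially"
    and ratio: "(\<lambda>n. cf_den a b n / cf_den a b (Suc n)) \<longlonglongrightarrow> 0"
    and bdd: "Bseq (\<lambda>n. cf_num a b n / cf_den a b n)"
    and u: "Bseq u"
  obtains g where "eventually (\<lambda>n. cf_S a b n (Fin (u n)) = Fin (g n)) sequentially"
    and "(\<lambda>n. g n - cf_num a b n / cf_den a b n) \<longlonglongrightarrow> 0"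
proof -
  define y where "y n = cf_num a b n / cf_den a b n" for n
  define g where "g n = (cf_num a b n + u n * cf_num_shift a b n) /
    (cf_den a b n + u n * cf_den_shift a b n)" for n
  define t where "t n = u (Suc n) * (cf_den a b n / cf_den a b (Suc n))" for n
  have "Bseq (\<lambda>n. u (Suc n))" using u by (simp add: Bseq_Suc_iff)
  then have t: "t \<longlonglongrightarrow> 0"
    using lim_null_mult_left_bounded ratio unfolding t_def[abs_def]
    by (metis Bfun_def)
  obtain K where K: "\<And>n. cmod (y n) \<le> K"
    using bdd by (auto simp: Bseq_def y_def)
  have w: "(\<lambda>n. t n / (1 + t n)) \<longlonglongrightarrow> 0"
    using tendsto_divide[OF t tendsto_add[OF tendsto_const t], of 1] by simp
  have nt: "eventually (\<lambda>n. 1 + t n \<noteq> 0) sequentially"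
    using tendsto_imp_eventually_ne[OF tendsto_add[OF tendsto_const t], of 1 0] by simp
  have nz1: "eventually (\<lambda>n. cf_den a b (Suc n) \<noteq> 0) sequentially"
    using nz eventually_sequentially_Suc[of "\<lambda>n. cf_den a b n \<noteq> 0"] by blast
  have fin: "eventually (\<lambda>n. cf_den a b (Suc n) + u (Suc n) * cf_den a b n \<noteq> 0) sequentially"
    using nt nz1
  proof eventually_elim
    case (elim n)
    then have "cf_den a b (Suc n) + u (Suc n) * cf_den a b n = cf_den a b (Suc n) * (1 + t n)"
      by (simp add: t_def field_simps)
    with elim show ?case by simp
  qed
  then have "eventually (\<lambda>n. cf_S a b (Suc n) (Fin (u (Suc n))) = Fin (g (Suc n))) sequentially"
    by eventually_elim (simp add: g_def xc_quot_def cf_den_def)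
  then have S: "eventually (\<lambda>n. cf_S a b n (Fin (u n)) = Fin (g n)) sequentially"
    using eventually_sequentially_Suc[of "\<lambda>n. cf_S a b n (Fin (u n)) = Fin (g n)"] by blast
  have "eventually (\<lambda>n. norm (g (Suc n) - y (Suc n)) \<le> cmod (t n / (1 + t n)) * (2 * K))
      sequentially"
    using fin nz nz1
  proof eventually_elim
    case (elim n)
    have "g (Suc n) - y (Suc n) = u (Suc n) * cf_den a b n /
        (u (Suc n) * cf_den a b n + 1 * cf_den a b (Suc n)) * (y n - y (Suc n))"
      using mediant_diff[of "cf_den a b n" "cf_den a b (Suc n)" "u (Suc n)" 1
          "cf_num a b n" "cf_num a b (Suc n)"] elim
      by (simp add: g_def y_def cf_num_def cf_den_def add.commute)
    also have "u (Suc n) * cf_den a b n / (u (Suc n) * cf_den a b n + 1 * cf_den a b (Suc n))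
        = t n / (1 + t n)"
      using elim by (simp add: t_def field_simps)
    finally have "norm (g (Suc n) - y (Suc n)) = cmod (t n / (1 + t n)) * cmod (y n - y (Suc n))"
      by (simp only: norm_mult)
    moreover have "cmod (y n - y (Suc n)) \<le> 2 * K"
      using norm_triangle_ineq4[of "y n" "y (Suc n)"] K[of n] K[of "Suc n"] by linarith
    ultimately show ?case by (simp add: mult_left_mono del: times_divide_eq_left)
  qed
  moreover have "(\<lambda>n. cmod (t n / (1 + t n)) * (2 * K)) \<longlonglongrightarrow> 0"
    using tendsto_mult_right[OF tendsto_norm[OF w], of "2 * K"] by simp
  ultimately have "(\<lambda>n. g (Suc n) - y (Suc n)) \<longlonglongrightarrow> 0" by (rule Lim_null_comparison)
  then have "(\<lambda>n. g n - y n) \<longlonglongrightarrow> 0" by (rule LIMSEQ_imp_Suc)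
  with S show ?thesis by (intro that) (simp_all add: y_def)
qed

section \<open>Failure of general convergence\<close>

text \<open>
  The separation of the two given sequences keeps at least one of them away from \<open>\<infinity>\<close> at each large
  index. Which one it is may change with the index, but $S_n$ of the chosen point still tends to
  $f$, since its distance to $f$ is at most the sum of the distances for both.
\<close>

lemma cf_converges_generally_bounded_witness:
  assumes "cf_converges_generally_to a b f"
  obtains u where "Bseq u" and "xc_tendsto (\<lambda>n. cf_S a b n (Fin (u n))) f"
proof -
  obtain v w where li: "liminf (\<lambda>n. ereal (chordal (v n) (w n))) > 0"
    and v: "xc_tendsto (\<lambda>n. cf_S a b n (v n)) f" and w: "xc_tendsto (\<lambda>n. cf_S a b n (w n)) f"
    using assms by (auto simp: cf_converges_generally_to_def)
  obtain \<delta> :: real where "\<delta> > 0" and \<delta>: "ereal \<delta> < liminf (\<lambda>n. ereal (chordal (v n) (w n)))"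
    using ereal_dense2[OF li] by auto
  have ev: "eventually (\<lambda>n. chordal (v n) (w n) > \<delta>) sequentially"
    using less_LiminfD[OF \<delta>] by simp
  define R where "R = 2 / \<delta>"
  have "R > 0" using \<open>\<delta> > 0\<close> by (simp add: R_def)
  \<comment> \<open>The value 0 stands in at the finitely many indices where both points may be far out.\<close>
  define u where "u n = (if \<exists>z. cmod z \<le> R \<and> (v n = Fin z \<or> w n = Fin z)
    then SOME z. cmod z \<le> R \<and> (v n = Fin z \<or> w n = Fin z) else 0)" for n
  have u: "cmod (u n) \<le> R \<and> (v n = Fin (u n) \<or> w n = Fin (u n))"
    if "\<exists>z. cmod z \<le> R \<and> (v n = Fin z \<or> w n = Fin z)" for n
    using someI_ex[OF that] that by (simp add: u_def)
  have "cmod (u n) \<le> R" for n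
    using u[of n] \<open>R > 0\<close> by (cases "\<exists>z. cmod z \<le> R \<and> (v n = Fin z \<or> w n = Fin z)")
      (auto simp: u_def)
  then have B: "Bseq u" by (rule BseqI')
  have "eventually (\<lambda>n. norm (chordal (cf_S a b n (Fin (u n))) f) \<le>
      chordal (cf_S a b n (v n)) f + chordal (cf_S a b n (w n)) f) sequentially"
    using ev
  proof eventually_elim
    case (elim n)
    have "\<exists>z. cmod z \<le> R \<and> (v n = Fin z \<or> w n = Fin z)"
    proof (rule ccontr)
      assume "\<not> ?thesis"
      then have "chordal (v n) (w n) \<le> 2 / R"
        by (intro chordal_large_le \<open>R > 0\<close>) (meson linear)+
      with elim \<open>\<delta> > 0\<close> show False by (simp add: R_def)
    qed
    with u have "v n = Fin (u n) \<or> w n = Fin (u n)" by blast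
    then show ?case
      using chordal_nonneg[of "cf_S a b n (v n)" f] chordal_nonneg[of "cf_S a b n (w n)" f] by auto
  qed
  moreover have "(\<lambda>n. chordal (cf_S a b n (v n)) f + chordal (cf_S a b n (w n)) f) \<longlonglongrightarrow> 0"
    using tendsto_add[OF v[unfolded xc_tendsto_def] w[unfolded xc_tendsto_def]] by simp
  ultimately have "xc_tendsto (\<lambda>n. cf_S a b n (Fin (u n))) f"
    unfolding xc_tendsto_def by (rule Lim_null_comparison)
  with B show ?thesis by (rule that)
qed

theorem theorem2:
  fixes a b :: "nat \<Rightarrow> complex" and l_even l_odd :: complex and c1 c2 c3 :: real
  assumes "cf_even_part_converges_to a b l_even"
    and "cf_odd_part_converges_to a b l_odd"
    and "l_even \<noteq> l_odd"
    and "c1 > 0" and "c2 > 0" and "c3 > 0"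
    and "\<And>i. i \<ge> 1 \<Longrightarrow> c1 \<le> cmod (b i) \<and> cmod (b i) \<le> c2"
    and "\<And>i. i \<ge> 1 \<Longrightarrow> cmod (a (2 * i + 1) / a (2 * i)) \<le> c3"
  shows "\<not> (\<exists>f :: xcomplex. cf_converges_generally_to a b f)"
proof
  assume "\<exists>f. cf_converges_generally_to a b f"
  then obtain f u where u: "Bseq u" and f: "xc_tendsto (\<lambda>n. cf_S a b n (Fin (u n))) f"
    using cf_converges_generally_bounded_witness by blast
  define y where "y n = cf_num a b n / cf_den a b n" for n
  note e = xc_tendsto_quot_FinD[OF assms(1)[unfolded cf_even_part_converges_to_def
      cf_approximant_def]]
  note o = xc_tendsto_quot_FinD[OF assms(2)[unfolded cf_odd_part_converges_to_def
      cf_approximant_def]]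
  have nz: "eventually (\<lambda>n. cf_den a b n \<noteq> 0) sequentially"
    using e(1) o(1) by (rule eventually_sequentially_parity)
  have ratio: "(\<lambda>n. cf_den a b n / cf_den a b (Suc n)) \<longlonglongrightarrow> 0"
    using assms(3,4,7) by (intro den_ratio_tendsto_0[OF e(2) o(2) _ nz]) auto
  have bdd: "Bseq y"
  proof -
    obtain K L where K: "\<And>n. cmod (y (2 * n)) \<le> K" and L: "\<And>n. cmod (y (2 * n + 1)) \<le> L"
      using convergentI[OF e(2), THEN convergent_imp_Bseq]
        convergentI[OF o(2), THEN convergent_imp_Bseq]
      by (auto simp: Bseq_def y_def)
    have "cmod (y n) \<le> max K L" for n
      using K[of "n div 2"] L[of "n div 2"] by (cases "even n") (auto simp: le_max_iff_disj)
    then show ?thesis by (rule BseqI')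
  qed
  obtain g where S: "eventually (\<lambda>n. cf_S a b n (Fin (u n)) = Fin (g n)) sequentially"
    and g: "(\<lambda>n. g n - y n) \<longlonglongrightarrow> 0"
    using cf_S_near_approximant[OF nz ratio _ u] bdd unfolding y_def by blast
  have "(\<lambda>n. chordal (Fin (g n)) f) \<longlonglongrightarrow> 0"
    using f unfolding xc_tendsto_def
    by (rule Lim_transform_eventually) (use S in eventually_elim, simp)
  then have lim: "f = Fin l"
    if k: "filterlim k sequentially sequentially" and l: "(\<lambda>n. y (k n)) \<longlonglongrightarrow> l" for k l
  proof -
    have "(\<lambda>n. chordal (Fin (g (k n))) f) \<longlonglongrightarrow> 0"
      using filterlim_compose[OF \<open>(\<lambda>n. chordal (Fin (g n)) f) \<longlonglongrightarrow> 0\<close> k] .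
    moreover have "(\<lambda>n. g (k n)) \<longlonglongrightarrow> l"
      using tendsto_add[OF filterlim_compose[OF g k] l] by simp
    ultimately show ?thesis
      by (intro xc_tendsto_Fin_unique) (simp_all add: xc_tendsto_def)
  qed
  have "f = Fin l_even" "f = Fin l_odd"
    using lim filterlim_double_sequentially e(2) o(2) unfolding y_def by blast+
  with assms(3) show False by simp
qed

end
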